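(* Let $\Omega\subset\mathbb{R}^N$ be open and let $F:\Omega\times\mathbb{R}\times\mathbb{R}^N\times\mathbb{S}^N\to\mathbb{R}$ satisfy (F1), (F2) and (F4). Let $u\in \mathrm{LSC}(\Omega)$ be a viscosity supersolution of $F(x,u,Du,D^2u)=0$ in $\Omega$, and assume that $\min_{\Omega}u=0$. Set $U=\{x\in\Omega : u(x)>0\}$. Then $U$ satisfies condition (G$_{F,\Omega}$), that is: if $\phi\in C^2(\Omega)$, $\hat x\in\Omega\setminus U$ and $\phi\le\phi(\hat x)=0$ in $\Omega\setminus U$, then $F(\hat x,\phi(\hat x),D\phi(\hat x),D^2\phi(\hat x))\le 0$.
   Context: $\mathbb{S}^N$ is the space of real symmetric $N\times N$ matrices with its usual order. Hypotheses on $F$: (F1) $F$ is continuous on $\Omega\times\mathbb{R}\times\mathbb{R}^N\times\mathbb{S}^N$. (F2) $F$ is degenerate elliptic: $F(x,r,p,X)\le F(x,r,p,Y)$ whenever $X\le Y$. (F4) There is a function $h:(0,\infty)\to(0,\infty)$ such that $F(x,r,tp,tX)=h(t)F(x,r,p,X)$ for all $t>0$ and all $(x,r,p,X)$. $\mathrm{LSC}(\Omega)$ is the set of lower semicontinuous functions $\Omega\to\mathbb{R}$. A function $u\in\mathrm{LSC}(\Omega)$ is a (viscosity) supersolution of $F(x,u,Du,D^2u)=0$ in $\Omega$ if, whenever $\phi\in C^2(\Omega)$ and $u-\phi$ has a local minimum at $\hat x\in\Omega$, one has $F(\hat x,u(\hat x),D\phi(\hat x),D^2\phi(\hat x))\le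 0$. *)

theory Defs
  imports "HOL-Analysis.Analysis"
begin

(* The dimension N is CARD('n). An operator F(x,r,p,X) on Omega x R x R^N x S^N is a curried
   total function; all conditions below constrain it only for x in Omega and X symmetric. *)
type_synonym 'n operator =
  "(real, 'n) vec \<Rightarrow> real \<Rightarrow> (real, 'n) vec \<Rightarrow> ((real, 'n) vec, 'n) vec \<Rightarrow> real"

definition sym_matrices :: "(real ^ 'n ^ 'n) set"
  where "sym_matrices = {X. transpose X = X}"

(* The order of quadratic forms. The library's order on vectors is componentwise,
   so "\<le>" on real ^ 'n ^ 'n would mean the entrywise order instead. *)
definition sym_le :: "real ^ 'n ^ 'n \<Rightarrow> real ^ 'n ^ 'n \<Rightarrow> bool"
  where "sym_le X Y \<longleftrightarrow> (\<forall>\<xi>. \<xi> \<bullet> (X *v \<xi>) \<le> \<xi> \<bullet> (Y *v \<xi>))"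

definition gradient :: "(real ^ 'n \<Rightarrow> real) \<Rightarrow> real ^ 'n \<Rightarrow> real ^ 'n"
  where "gradient f x = (\<chi> i. frechet_derivative f (at x) (axis i 1))"

definition hessian :: "(real ^ 'n \<Rightarrow> real) \<Rightarrow> real ^ 'n \<Rightarrow> real ^ 'n ^ 'n"
  where "hessian f x = jacobian (gradient f) (at x)"

(* Meant for open \<Omega>. Continuity of f and of its gradient follow from differentiability. *)
definition C2_on :: "(real ^ 'n) set \<Rightarrow> (real ^ 'n \<Rightarrow> real) \<Rightarrow> bool"
  where "C2_on \<Omega> f \<longleftrightarrow>
    (\<forall>x\<in>\<Omega>. f differentiable at x) \<and>
    (\<forall>x\<in>\<Omega>. gradient f differentiable at x) \<and>
    continuous_on \<Omega> (hessian f)"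

definition lsc_on :: "'a::topological_space set \<Rightarrow> ('a \<Rightarrow> real) \<Rightarrow> bool"
  where "lsc_on \<Omega> u \<longleftrightarrow> (\<forall>x\<in>\<Omega>. \<forall>a < u x. \<forall>\<^sub>F y in at x within \<Omega>. a < u y)"

definition local_min_in :: "'a::topological_space set \<Rightarrow> ('a \<Rightarrow> real) \<Rightarrow> 'a \<Rightarrow> bool"
  where "local_min_in \<Omega> f x \<longleftrightarrow> (\<forall>\<^sub>F y in at x within \<Omega>. f x \<le> f y)"

definition continuous_operator :: "(real ^ 'n) set \<Rightarrow> 'n::finite operator \<Rightarrow> bool"
  where "continuous_operator \<Omega> F \<longleftrightarrow>
    continuous_on (\<Omega> \<times> UNIV \<times> UNIV \<times> sym_matrices) (\<lambda>(x, r, p, X). F x r p X)"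

definition degenerate_elliptic :: "(real ^ 'n) set \<Rightarrow> 'n::finite operator \<Rightarrow> bool"
  where "degenerate_elliptic \<Omega> F \<longleftrightarrow>
    (\<forall>x\<in>\<Omega>. \<forall>r p. \<forall>X\<in>sym_matrices. \<forall>Y\<in>sym_matrices.
       sym_le X Y \<longrightarrow> F x r p X \<le> F x r p Y)"

definition homogeneous_operator :: "(real ^ 'n) set \<Rightarrow> 'n::finite operator \<Rightarrow> bool"
  where "homogeneous_operator \<Omega> F \<longleftrightarrow>
    (\<exists>h :: real \<Rightarrow> real. (\<forall>t>0. h t > 0) \<and>
       (\<forall>t>0. \<forall>x\<in>\<Omega>. \<forall>r p. \<forall>X\<in>sym_matrices.
          F x r (t *\<^sub>R p) (t *\<^sub>R X) = h t * F x r p X))"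

definition viscosity_supersolution ::
    "(real ^ 'n) set \<Rightarrow> 'n::finite operator \<Rightarrow> (real ^ 'n \<Rightarrow> real) \<Rightarrow> bool"
  where "viscosity_supersolution \<Omega> F u \<longleftrightarrow> lsc_on \<Omega> u \<and>
    (\<forall>\<phi> x. C2_on \<Omega> \<phi> \<longrightarrow> x \<in> \<Omega> \<longrightarrow> local_min_in \<Omega> (\<lambda>y. u y - \<phi> y) x \<longrightarrow>
       F x (u x) (gradient \<phi> x) (hessian \<phi> x) \<le> 0)"

definition G_condition ::
    "'n::finite operator \<Rightarrow> (real ^ 'n) set \<Rightarrow> (real ^ 'n) set \<Rightarrow> bool"
  where "G_condition F \<Omega> U \<longleftrightarrow>
    (\<forall>\<phi> x. C2_on \<Omega> \<phi> \<longrightarrow> x \<in> \<Omega> - U \<longrightarrow> \<phi> x = 0 \<longrightarrow> (\<forall>y\<in>\<Omega> - U. \<phi> y \<le> \<phi> x) \<longrightarrow>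
       F x (\<phi> x) (gradient \<phi> x) (hessian \<phi> x) \<le> 0)"

end

theory Submission
  imports Defs
begin

(* Multiples \<epsilon>\<psi> of a test function are again admissible up to the factor h(\<epsilon>) > 0.
   If \<psi> < 0 on the zero set of u except at a, where \<psi>(a) = 0, then the minimum points x\<^sub>\<epsilon> of
   u - \<epsilon>\<psi> over a closed ball around a satisfy 0 \<le> u(x\<^sub>\<epsilon>) \<le> \<epsilon>\<psi>(x\<^sub>\<epsilon>), so by lower semicontinuity
   they converge to a as \<epsilon> tends to 0. The supersolution inequality at x\<^sub>\<epsilon> divided by h(\<epsilon>) passes
   to the limit and gives the inequality for \<psi> at a. For general \<phi> take
   \<psi>(y) = \<phi>(y) - \<delta>|y - a|^2 and let \<delta> tend to 0. *)

section \<open>Gradient and Hessian\<close>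

lemma has_derivative_gradient:
  assumes "f differentiable at x"
  shows "(f has_derivative (\<lambda>h. gradient f x \<bullet> h)) (at x)"
proof -
  let ?D = "frechet_derivative f (at x)"
  have D: "(f has_derivative ?D) (at x)"
    using assms frechet_derivative_works by blast
  then have lin: "linear ?D"
    by (rule has_derivative_linear)
  have "?D h = gradient f x \<bullet> h" for h
  proof -
    have "?D h = ?D (\<Sum>i\<in>UNIV. (h $ i) *\<^sub>R axis i 1)"
      using basis_expansion[of h] by (simp add: scalar_mult_eq_scaleR)
    also have "\<dots> = (\<Sum>i\<in>UNIV. (h $ i) * ?D (axis i 1))"
      by (simp add: linear_sum[OF lin] linear_scale[OF lin])
    finally show ?thesis
      by (simp add: gradient_def inner_vec_def mult.commute)
  qed
  then have "?D = (\<lambda>h. gradient f x \<bullet> h)" by blast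
  with D show ?thesis by simp
qed

lemma gradient_eqI:
  assumes "(f has_derivative (\<lambda>h. g \<bullet> h)) (at x)"
  shows "gradient f x = g"
  using frechet_derivative_at[OF assms, symmetric]
  by (simp add: gradient_def vec_eq_iff inner_axis)

lemma C2_onD:
  assumes "C2_on \<Omega> f" "x \<in> \<Omega>"
  shows "(f has_derivative (\<lambda>h. gradient f x \<bullet> h)) (at x)"
    and "(gradient f has_derivative (\<lambda>h. hessian f x *v h)) (at x)"
  using assms unfolding C2_on_def hessian_def
  by (simp_all add: has_derivative_gradient flip: jacobian_works)

text \<open>Explicit candidates \<open>G\<close> and \<open>H\<close> give membership in C^2 and
  both formulas at once. Since \<open>G\<close> equals \<open>gradient f\<close> only on \<Omega>,
  openness is what carries the derivative of \<open>G\<close> over to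
  \<open>gradient f\<close>.\<close>

lemma C2_onI:
  assumes "open \<Omega>"
    and f: "\<And>x. x \<in> \<Omega> \<Longrightarrow> (f has_derivative (\<lambda>h. G x \<bullet> h)) (at x)"
    and G: "\<And>x. x \<in> \<Omega> \<Longrightarrow> (G has_derivative (\<lambda>h. H x *v h)) (at x)"
    and H: "continuous_on \<Omega> H"
  shows "C2_on \<Omega> f"
    and "x \<in> \<Omega> \<Longrightarrow> gradient f x = G x"
    and "x \<in> \<Omega> \<Longrightarrow> hessian f x = H x"
proof -
  show grad: "gradient f x = G x" if "x \<in> \<Omega>" for x
    using f[OF that] by (rule gradient_eqI)
  have der: "(gradient f has_derivative (\<lambda>h. H x *v h)) (at x)" if "x \<in> \<Omega>" for x
    using has_derivative_transform_within_open[OF G[OF that] \<open>open \<Omega>\<close> that] grad by metis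
  show hess: "hessian f x = H x" if "x \<in> \<Omega>" for x
    using frechet_derivative_at[OF der[OF that], symmetric]
    by (simp add: hessian_def jacobian_def)
  have "continuous_on \<Omega> (hessian f)"
    using H hess continuous_on_cong by metis
  then show "C2_on \<Omega> f"
    unfolding C2_on_def differentiable_def using f der by blast
qed

text \<open>Gradient and Hessian pick up the same factor, which is the form of scaling that
  \<open>homogeneous_operator\<close> speaks about.\<close>

lemma C2_on_scale:
  fixes f :: "real ^ 'n \<Rightarrow> real"
  assumes "open \<Omega>" "C2_on \<Omega> f"
  shows "C2_on \<Omega> (\<lambda>y. c * f y)"
    and "x \<in> \<Omega> \<Longrightarrow> gradient (\<lambda>y. c * f y) x = c *\<^sub>R gradient f x"
    and "x \<in> \<Omega> \<Longrightarrow> hessian (\<lambda>y. c * f y) x = c *\<^sub>R hessian f x"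
proof -
  have 1: "((\<lambda>y. c * f y) has_derivative (\<lambda>h. (c *\<^sub>R gradient f y) \<bullet> h)) (at y)" if "y \<in> \<Omega>" for y
    using has_derivative_mult_right[OF C2_onD(1)[OF assms(2) that], of c] by simp
  have 2: "((\<lambda>y. c *\<^sub>R gradient f y) has_derivative (\<lambda>h. (c *\<^sub>R hessian f y) *v h)) (at y)"
    if "y \<in> \<Omega>" for y
    using has_derivative_scaleR_right[OF C2_onD(2)[OF assms(2) that], of c]
    by (simp add: scaleR_matrix_vector_assoc)
  have 3: "continuous_on \<Omega> (\<lambda>y. c *\<^sub>R hessian f y)"
    using assms(2) unfolding C2_on_def by (intro continuous_intros) auto
  show "C2_on \<Omega> (\<lambda>y. c * f y)"
    and "x \<in> \<Omega> \<Longrightarrow> gradient (\<lambda>y. c * f y) x = c *\<^sub>R gradient f x"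
    and "x \<in> \<Omega> \<Longrightarrow> hessian (\<lambda>y. c * f y) x = c *\<^sub>R hessian f x"
    using C2_onI[OF assms(1) 1 2 3] by blast+
qed

text \<open>The quadratic penalty makes a maximum at \<open>a\<close> strict. At \<open>a\<close>
  itself it leaves the gradient unchanged and shifts the Hessian by a multiple of the
  identity.\<close>

lemma C2_on_diff_square:
  fixes f :: "real ^ 'n \<Rightarrow> real"
  assumes "open \<Omega>" "C2_on \<Omega> f"
  shows "C2_on \<Omega> (\<lambda>y. f y - c * ((y - a) \<bullet> (y - a)))"
    and "x \<in> \<Omega> \<Longrightarrow> gradient (\<lambda>y. f y - c * ((y - a) \<bullet> (y - a))) x
           = gradient f x - (2 * c) *\<^sub>R (x - a)"
    and "x \<in> \<Omega> \<Longrightarrow> hessian (\<lambda>y. f y - c * ((y - a) \<bullet> (y - a))) x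
           = hessian f x - (2 * c) *\<^sub>R mat 1"
proof -
  let ?f = "\<lambda>y. f y - c * ((y - a) \<bullet> (y - a))"
  have 1: "(?f has_derivative (\<lambda>h. (gradient f y - (2 * c) *\<^sub>R (y - a)) \<bullet> h)) (at y)"
    if "y \<in> \<Omega>" for y
    by (rule derivative_eq_intros C2_onD(1)[OF assms(2) that] refl ext)+
       (simp add: algebra_simps inner_commute)
  have 2: "((\<lambda>y. gradient f y - (2 * c) *\<^sub>R (y - a)) has_derivative
             (\<lambda>h. (hessian f y - (2 * c) *\<^sub>R mat 1) *v h)) (at y)"
    if "y \<in> \<Omega>" for y
    by (rule derivative_eq_intros C2_onD(2)[OF assms(2) that] refl ext)+
       (simp add: matrix_vector_mult_diff_rdistrib flip: scaleR_matrix_vector_assoc)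
  have 3: "continuous_on \<Omega> (\<lambda>y. hessian f y - (2 * c) *\<^sub>R mat 1)"
    using assms(2) unfolding C2_on_def by (intro continuous_intros) auto
  show "C2_on \<Omega> ?f"
    and "x \<in> \<Omega> \<Longrightarrow> gradient ?f x = gradient f x - (2 * c) *\<^sub>R (x - a)"
    and "x \<in> \<Omega> \<Longrightarrow> hessian ?f x = hessian f x - (2 * c) *\<^sub>R mat 1"
    using C2_onI[OF assms(1) 1 2 3] by blast+
qed

section \<open>Symmetry of second derivatives\<close>

text \<open>The mean value theorem in direction \<open>v\<close> turns the second difference into a
  difference of two values of \<open>G\<close>; each is then expanded to first order at
  \<open>x\<close>. This needs only the expansion at \<open>x\<close>, not continuity of a second
  derivative.\<close>

lemma second_difference_estimate:
  fixes f :: "'a::real_inner \<Rightarrow> real"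
  assumes f: "\<And>y. y \<in> ball x d \<Longrightarrow> (f has_derivative (\<lambda>k. G y \<bullet> k)) (at y)"
    and G: "\<And>y. y \<in> ball x d \<Longrightarrow> norm (G y - G x - A (y - x)) \<le> e * norm (y - x)"
    and "linear A" "h > 0" "e \<ge> 0" and h: "h * (norm v + norm w) < d"
  shows "\<bar>f (x + h *\<^sub>R v + h *\<^sub>R w) - f (x + h *\<^sub>R v) - f (x + h *\<^sub>R w) + f x - h\<^sup>2 * (A w \<bullet> v)\<bar>
           \<le> h\<^sup>2 * (2 * e * (norm v + norm w)\<^sup>2)"
proof -
  have bound: "norm (t *\<^sub>R v + s *\<^sub>R w) \<le> h * (norm v + norm w)"
    if "0 \<le> t" "t \<le> h" "0 \<le> s" "s \<le> h" for t s
  proof -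
    have "norm (t *\<^sub>R v + s *\<^sub>R w) \<le> t * norm v + s * norm w"
      using norm_triangle_ineq[of "t *\<^sub>R v" "s *\<^sub>R w"] that by simp
    also have "\<dots> \<le> h * norm v + h * norm w"
      using that by (intro add_mono mult_right_mono) auto
    finally show ?thesis by (simp add: algebra_simps)
  qed
  have in_ball: "x + (t *\<^sub>R v + s *\<^sub>R w) \<in> ball x d"
    if "0 \<le> t" "t \<le> h" "0 \<le> s" "s \<le> h" for t s
  proof -
    have "dist x (x + z) = norm z" for z by (simp add: dist_norm)
    then show ?thesis using bound[OF that] h by (simp only: mem_ball)
  qed
  \<comment> \<open>The summand \<open>0 *\<^sub>R w\<close> is kept so that both terms are
    instances of \<open>line\<close>, with \<open>s = h\<close> and \<open>s = 0\<close>.\<close>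
  define g where "g t = f (x + (t *\<^sub>R v + h *\<^sub>R w)) - f (x + (t *\<^sub>R v + 0 *\<^sub>R w))" for t
  define g' where "g' t = (G (x + (t *\<^sub>R v + h *\<^sub>R w)) - G (x + (t *\<^sub>R v + 0 *\<^sub>R w))) \<bullet> v" for t
  have line: "((\<lambda>t. f (x + (t *\<^sub>R v + s *\<^sub>R w))) has_derivative
               (\<lambda>k. G (x + (t *\<^sub>R v + s *\<^sub>R w)) \<bullet> (k *\<^sub>R v))) (at t)"
    if "0 \<le> t" "t \<le> h" "0 \<le> s" "s \<le> h" for t s
  proof -
    have "((\<lambda>t. x + (t *\<^sub>R v + s *\<^sub>R w)) has_derivative (\<lambda>k. k *\<^sub>R v)) (at t)"
      by (auto intro!: derivative_eq_intros)
    from has_derivative_compose[OF this f[OF in_ball[OF that]]] show ?thesis .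
  qed
  have g: "(g has_real_derivative g' t) (at t)" if "0 \<le> t" "t \<le> h" for t
    unfolding g_def[abs_def] g'_def has_field_derivative_def
    by (rule has_derivative_eq_rhs[OF has_derivative_diff[OF line[OF that, of h] line[OF that, of 0]]])
       (use \<open>h > 0\<close> in \<open>auto simp: fun_eq_iff algebra_simps\<close>)
  obtain t where t: "0 < t" "t < h" "g h - g 0 = (h - 0) * g' t"
    using MVT2[OF \<open>h > 0\<close> g] by blast
  define r where "r s = G (x + (t *\<^sub>R v + s *\<^sub>R w)) - G x - A (t *\<^sub>R v + s *\<^sub>R w)" for s
  have r: "norm (r s) \<le> e * (h * (norm v + norm w))" if "0 \<le> s" "s \<le> h" for s
  proof -
    have "norm (r s) \<le> e * norm (t *\<^sub>R v + s *\<^sub>R w)"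
      using G[OF in_ball, of t s] t that by (simp add: r_def)
    also have "\<dots> \<le> e * (h * (norm v + norm w))"
      using bound[of t s] t that \<open>e \<ge> 0\<close> by (intro mult_left_mono) auto
    finally show ?thesis .
  qed
  \<comment> \<open>The contributions \<open>A (t *\<^sub>R v)\<close> of the two expansions cancel,
    which leaves \<open>h\<close> times \<open>A w\<close> and two remainders.\<close>
  have g't: "g' t = h * (A w \<bullet> v) + (r h - r 0) \<bullet> v"
    by (simp add: g'_def r_def linear_add[OF \<open>linear A\<close>] linear_scale[OF \<open>linear A\<close>] algebra_simps)
  have "g h - g 0 - h\<^sup>2 * (A w \<bullet> v) = h * ((r h - r 0) \<bullet> v)"
    unfolding t(3) g't by (simp add: algebra_simps power2_eq_square)
  also have "\<bar>\<dots>\<bar> \<le> h * ((2 * (e * (h * (norm v + norm w)))) * (norm v + norm w))"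
  proof -
    have "\<bar>(r h - r 0) \<bullet> v\<bar> \<le> norm (r h - r 0) * norm v"
      by (rule Cauchy_Schwarz_ineq2)
    \<comment> \<open>The factor \<open>norm v\<close> is enlarged to \<open>norm v + norm w\<close>
      to make the bound symmetric in \<open>v\<close> and \<open>w\<close>.\<close>
    also have "\<dots> \<le> (2 * (e * (h * (norm v + norm w)))) * (norm v + norm w)"
      using r[of h] r[of 0] norm_triangle_ineq4[of "r h" "r 0"] \<open>h > 0\<close> \<open>e \<ge> 0\<close>
      by (intro mult_mono) auto
    finally show ?thesis
      using \<open>h > 0\<close> by (simp add: abs_mult)
  qed
  finally show ?thesis
    by (simp add: g_def algebra_simps power2_eq_square)
qed

text \<open>The second difference does not change when \<open>v\<close> and \<open>w\<close> are
  exchanged, so after division by the square of \<open>h\<close> it approximates both sides with an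
  error of order \<open>e\<close>, for every \<open>e > 0\<close>.\<close>

lemma second_derivative_symmetric:
  fixes f :: "'a::real_inner \<Rightarrow> real"
  assumes "open S" "x \<in> S"
    and f: "\<And>y. y \<in> S \<Longrightarrow> (f has_derivative (\<lambda>k. G y \<bullet> k)) (at y)"
    and G: "(G has_derivative A) (at x)"
  shows "A v \<bullet> w = A w \<bullet> v"
proof -
  define C where "C = 4 * (norm v + norm w)\<^sup>2"
  have "\<bar>A v \<bullet> w - A w \<bullet> v\<bar> \<le> e * C" if "e > 0" for e
  proof -
    obtain d1 where d1: "d1 > 0" "ball x d1 \<subseteq> S"
      using assms(1,2) open_contains_ball by blast
    obtain d2 where d2: "d2 > 0"
      "\<And>y. norm (y - x) < d2 \<Longrightarrow> norm (G y - G x - A (y - x)) \<le> e * norm (y - x)"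
      using G \<open>e > 0\<close> unfolding has_derivative_at_alt by blast
    define d where "d = min d1 d2"
    have "d > 0" using d1 d2 by (simp add: d_def)
    \<comment> \<open>The added 1 covers the case \<open>v = w = 0\<close> and makes
      \<open>h * (norm v + norm w) = d - h\<close> strictly less than \<open>d\<close>.\<close>
    define h where "h = d / (norm v + norm w + 1)"
    have N: "norm v + norm w + 1 > 0" by (simp add: add_nonneg_pos)
    then have "h > 0" using \<open>d > 0\<close> by (simp add: h_def)
    have "h * (norm v + norm w + 1) = d" using N by (simp add: h_def)
    then have h: "h * (norm v + norm w) < d" using \<open>h > 0\<close> by (simp add: algebra_simps)
    have f': "(f has_derivative (\<lambda>k. G y \<bullet> k)) (at y)" if "y \<in> ball x d" for y
      using f d1 that by (auto simp: d_def)
    have G': "norm (G y - G x - A (y - x)) \<le> e * norm (y - x)" if "y \<in> ball x d" for y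
      using that by (intro d2(2)) (simp add: d_def dist_norm norm_minus_commute)
    have lin: "linear A" using G by (rule has_derivative_linear)
    let ?D = "f (x + h *\<^sub>R v + h *\<^sub>R w) - f (x + h *\<^sub>R v) - f (x + h *\<^sub>R w) + f x"
    have "\<bar>?D - h\<^sup>2 * (A w \<bullet> v)\<bar> \<le> h\<^sup>2 * (2 * e * (norm v + norm w)\<^sup>2)"
      by (rule second_difference_estimate[OF f' G' lin \<open>h > 0\<close> _ h]) (use \<open>e > 0\<close> in auto)
    moreover have "\<bar>?D - h\<^sup>2 * (A v \<bullet> w)\<bar> \<le> h\<^sup>2 * (2 * e * (norm v + norm w)\<^sup>2)"
      using second_difference_estimate[OF f' G' lin \<open>h > 0\<close>, where v = w and w = v] \<open>e > 0\<close> h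
      by (simp add: algebra_simps)
    ultimately have "\<bar>h\<^sup>2 * (A v \<bullet> w) - h\<^sup>2 * (A w \<bullet> v)\<bar> \<le> h\<^sup>2 * (e * C)"
      unfolding C_def by (simp add: algebra_simps)
    then have "h\<^sup>2 * \<bar>A v \<bullet> w - A w \<bullet> v\<bar> \<le> h\<^sup>2 * (e * C)"
      by (simp add: abs_mult flip: right_diff_distrib)
    then show ?thesis using \<open>h > 0\<close> by simp
  qed
  then have "\<bar>A v \<bullet> w - A w \<bullet> v\<bar> \<le> 0 + e" if "e > 0" for e
  proof -
    have C: "C \<ge> 0" by (simp add: C_def)
    \<comment> \<open>\<open>C\<close> vanishes when both vectors do, hence the division by
      \<open>C + 1\<close>.\<close>
    have "\<bar>A v \<bullet> w - A w \<bullet> v\<bar> \<le> e / (C + 1) * C"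
      using \<open>\<And>e. e > 0 \<Longrightarrow> _ \<le> e * C\<close>[of "e / (C + 1)"] that C by simp
    also have "\<dots> \<le> e" using that C by (simp add: divide_simps)
    finally show ?thesis by simp
  qed
  then have "\<bar>A v \<bullet> w - A w \<bullet> v\<bar> \<le> 0" by (rule field_le_epsilon)
  then show ?thesis by simp
qed

text \<open>The conditions on \<open>F\<close> constrain it only at symmetric matrices, so this is
  required before continuity or homogeneity can be applied at a Hessian.\<close>

lemma hessian_symmetric:
  assumes "open \<Omega>" "C2_on \<Omega> f" "x \<in> \<Omega>"
  shows "hessian f x \<in> sym_matrices"
proof -
  let ?H = "hessian f x"
  have sym: "(?H *v v) \<bullet> w = (?H *v w) \<bullet> v" for v w
    using second_derivative_symmetric[OF assms(1,3) C2_onD(1)[OF assms(2)] C2_onD(2)[OF assms(2,3)]] .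
  have entry: "?H $ i $ j = (?H *v axis j 1) \<bullet> axis i 1" for i j
    by (simp add: matrix_vector_mult_basis column_def inner_axis)
  show ?thesis
    unfolding sym_matrices_def transpose_def using entry sym by (simp add: vec_eq_iff)
qed

section \<open>Lower semicontinuous functions\<close>

lemma lsc_on_subset:
  assumes "lsc_on S f" "T \<subseteq> S"
  shows "lsc_on T f"
  using assms unfolding lsc_on_def by (meson at_le filter_leD subsetD)

lemma lsc_on_diff_continuous:
  assumes "lsc_on S f" "continuous_on S g"
  shows "lsc_on S (\<lambda>y. f y - g y)"
  unfolding lsc_on_def
proof (intro ballI allI impI)
  fix x a assume x: "x \<in> S" and a: "a < f x - g x"
  define e where "e = (f x - g x - a) / 2"
  have e: "e > 0" using a by (simp add: e_def)
  have "\<forall>\<^sub>F y in at x within S. f x - e < f y"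
    using assms(1) x e unfolding lsc_on_def by auto
  moreover have "\<forall>\<^sub>F y in at x within S. g y < g x + e"
    using assms(2) x e order_tendstoD(2)[of g "g x" _ "g x + e"]
    unfolding continuous_on_def by auto
  ultimately show "\<forall>\<^sub>F y in at x within S. a < f y - g y"
  proof eventually_elim
    case (elim y)
    then show ?case using a by (simp add: e_def field_simps)
  qed
qed

text \<open>The definition of \<open>lsc_on\<close> speaks of punctured neighbourhoods; this form
  includes the point itself and suits covering arguments.\<close>

lemma lsc_on_openin:
  assumes "lsc_on S f"
  shows "openin (top_of_set S) {y \<in> S. a < f y}"
proof (subst openin_subopen, intro ballI)
  fix x assume "x \<in> {y \<in> S. a < f y}"
  then have x: "x \<in> S" "a < f x" by auto
  then have "\<forall>\<^sub>F y in at x within S. a < f y"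
    using assms unfolding lsc_on_def by blast
  then obtain T where "open T" "x \<in> T" "\<forall>y\<in>T. y \<noteq> x \<longrightarrow> y \<in> S \<longrightarrow> a < f y"
    unfolding eventually_at_topological by blast
  then show "\<exists>T. openin (top_of_set S) T \<and> x \<in> T \<and> T \<subseteq> {y \<in> S. a < f y}"
    using x by (intro exI[of _ "S \<inter> T"]) (auto simp: openin_open)
qed

text \<open>If no minimum existed, the relatively open sets \<open>{y \<in> S. f z < f y}\<close>
  would cover \<open>S\<close>. In a finite subcover indexed by \<open>Z\<close>, a point of
  \<open>Z\<close> with least value lies in none of the sets.\<close>

lemma lsc_on_attains_inf:
  assumes "compact S" "S \<noteq> {}" "lsc_on S f"
  shows "\<exists>x\<in>S. \<forall>y\<in>S. f x \<le> f y"
proof (rule ccontr)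
  assume "\<not> ?thesis"
  then have no_min: "\<exists>z\<in>S. f z < f y" if "y \<in> S" for y
    using that not_le by metis
  let ?C = "(\<lambda>z. {y \<in> S. f z < f y}) ` S"
  have "\<forall>c\<in>?C. openin (top_of_set S) c" "S \<subseteq> \<Union>?C"
    using lsc_on_openin[OF assms(3)] no_min by auto
  then obtain D where D: "D \<subseteq> ?C" "finite D" "S \<subseteq> \<Union>D"
    using assms(1) unfolding compact_eq_openin_cover by meson
  then obtain Z where Z: "Z \<subseteq> S" "finite Z" "D = (\<lambda>z. {y \<in> S. f z < f y}) ` Z"
    by (meson finite_subset_image)
  with D \<open>S \<noteq> {}\<close> have "Z \<noteq> {}" by auto
  then have "Min (f ` Z) \<in> f ` Z" using Z by simp
  then obtain m where m: "m \<in> Z" "f m = Min (f ` Z)" by auto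
  then obtain z where "z \<in> Z" "f z < f m" using D Z by blast
  then show False using m Z(2) by (metis Min_le finite_imageI imageI not_le)
qed

text \<open>A number strictly between \<open>c\<close> and \<open>f x\<close> would eventually lie
  below \<open>f (X n)\<close> and above \<open>b n\<close>. Terms with \<open>X n = x\<close> are
  allowed, which is why the open set form of semicontinuity is used.\<close>

lemma lsc_on_limit_le:
  fixes f :: "'a::first_countable_topology \<Rightarrow> real"
  assumes "lsc_on S f" "x \<in> S" "\<And>n. X n \<in> S" "X \<longlonglongrightarrow> x" "b \<longlonglongrightarrow> c" "\<And>n. f (X n) \<le> b n"
  shows "f x \<le> c"
proof (rule ccontr)
  assume "\<not> f x \<le> c"
  then obtain a where a: "c < a" "a < f x" using dense not_le by blast
  then obtain T where T: "open T" "{y \<in> S. a < f y} = S \<inter> T"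
    using lsc_on_openin[OF assms(1)] unfolding openin_open by metis
  then have "x \<in> T" using assms(2) a by blast
  then have "\<forall>\<^sub>F n in sequentially. X n \<in> T"
    using assms(4) T(1) by (simp add: topological_tendstoD)
  moreover have "\<forall>\<^sub>F n in sequentially. b n < a"
    using assms(5) a by (simp add: order_tendstoD)
  ultimately have "\<forall>\<^sub>F n in sequentially. False"
  proof eventually_elim
    case (elim n)
    then have "a < f (X n)" using T assms(3)[of n] by blast
    then show ?case using elim assms(6)[of n] by simp
  qed
  then show False by simp
qed

section \<open>Test functions vanishing strictly on the zero set\<close>

text \<open>The filter is arbitrary because the limit is taken both along a sequence of minimum
  points and as the penalty parameter tends to 0 from the right.\<close>

lemma continuous_operator_tendsto:
  assumes "continuous_operator \<Omega> F"
    and "x \<in> \<Omega>" "A \<in> sym_matrices" "\<forall>\<^sub>F n in L. X n \<in> \<Omega>" "\<forall>\<^sub>F n in L. H n \<in> sym_matrices"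
    and "(X \<longlongrightarrow> x) L" "(r \<longlongrightarrow> s) L" "(P \<longlongrightarrow> p) L" "(H \<longlongrightarrow> A) L"
  shows "((\<lambda>n. F (X n) (r n) (P n) (H n)) \<longlongrightarrow> F x s p A) L"
proof -
  have "((\<lambda>n. (\<lambda>(x, r, p, X). F x r p X) (X n, r n, P n, H n)) \<longlongrightarrow>
         (\<lambda>(x, r, p, X). F x r p X) (x, s, p, A)) L"
    using assms(1) unfolding continuous_operator_def
    by (rule continuous_on_tendsto_compose)
       (use assms(2-) in \<open>auto intro!: tendsto_Pair elim: eventually_elim2\<close>)
  then show ?thesis by simp
qed

text \<open>Strictness identifies the limit \<open>l\<close> of the minimum points: it satisfies
  \<open>u l = 0\<close> and \<open>0 \<le> \<psi> l\<close>, and \<open>a\<close> is the only such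
  point.\<close>

lemma supersolution_strict_test:
  fixes F :: "'n::finite operator"
  assumes "open \<Omega>" and F: "continuous_operator \<Omega> F" "homogeneous_operator \<Omega> F"
    and u: "viscosity_supersolution \<Omega> F u" "\<And>x. x \<in> \<Omega> \<Longrightarrow> 0 \<le> u x"
    and \<psi>: "C2_on \<Omega> \<psi>" and a: "a \<in> \<Omega>" "u a = 0" "\<psi> a = 0"
    and strict: "\<And>y. y \<in> \<Omega> \<Longrightarrow> u y = 0 \<Longrightarrow> y \<noteq> a \<Longrightarrow> \<psi> y < 0"
  shows "F a 0 (gradient \<psi> a) (hessian \<psi> a) \<le> 0"
proof -
  obtain h where h: "\<And>t. t > 0 \<Longrightarrow> h t > 0"
    "\<And>t x r p X. t > 0 \<Longrightarrow> x \<in> \<Omega> \<Longrightarrow> X \<in> sym_matrices \<Longrightarrow>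
       F x r (t *\<^sub>R p) (t *\<^sub>R X) = h t * F x r p X"
    using F(2) unfolding homogeneous_operator_def by metis
  have lsc: "lsc_on \<Omega> u"
    using u(1) unfolding viscosity_supersolution_def by blast
  have cont: "isCont \<psi> x" "isCont (gradient \<psi>) x" "isCont (hessian \<psi>) x" if "x \<in> \<Omega>" for x
    using \<psi> that \<open>open \<Omega>\<close> unfolding C2_on_def
    by (auto intro: differentiable_imp_continuous_within simp: continuous_on_eq_continuous_at)
  then have cont_on: "continuous_on \<Omega> \<psi>"
    by (simp add: continuous_at_imp_continuous_on)
  obtain R where R: "R > 0" "cball a R \<subseteq> \<Omega>"
    using \<open>open \<Omega>\<close> a(1) open_contains_cball by blast
  let ?K = "cball a R"
  define \<epsilon> where "\<epsilon> n = inverse (real (Suc n))" for n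
  have \<epsilon>: "\<epsilon> n > 0" for n by (simp add: \<epsilon>_def)
  have "\<exists>x\<in>?K. \<forall>y\<in>?K. u x - \<epsilon> n * \<psi> x \<le> u y - \<epsilon> n * \<psi> y" for n
  proof -
    have "lsc_on ?K (\<lambda>y. u y - \<epsilon> n * \<psi> y)"
      by (intro lsc_on_diff_continuous lsc_on_subset[OF lsc R(2)] continuous_intros
          continuous_on_subset[OF cont_on R(2)])
    then show ?thesis
      using R(1) by (intro lsc_on_attains_inf) auto
  qed
  then obtain X where X: "\<And>n. X n \<in> ?K"
    "\<And>n y. y \<in> ?K \<Longrightarrow> u (X n) - \<epsilon> n * \<psi> (X n) \<le> u y - \<epsilon> n * \<psi> y"
    by metis
  obtain l k where k: "l \<in> ?K" "strict_mono k" "(X \<circ> k) \<longlonglongrightarrow> l"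
    using compact_cball[of a R] X(1) unfolding compact_def by metis
  define Y where "Y = X \<circ> k"
  define e where "e n = \<epsilon> (k n)" for n
  have e: "e n > 0" for n using \<epsilon> by (simp add: e_def)
  have "e \<longlonglongrightarrow> 0"
    using LIMSEQ_subseq_LIMSEQ[OF LIMSEQ_inverse_real_of_nat k(2)]
    by (simp add: e_def[abs_def] \<epsilon>_def o_def)
  have Yl: "Y \<longlonglongrightarrow> l" using k by (simp add: Y_def)
  have Y\<Omega>: "Y n \<in> \<Omega>" for n using X R by (auto simp: Y_def)
  have l\<Omega>: "l \<in> \<Omega>" using k R by blast
  have min: "u (Y n) - e n * \<psi> (Y n) \<le> u y - e n * \<psi> y" if "y \<in> ?K" for n y
    using X(2)[OF that] by (simp add: Y_def e_def)
  \<comment> \<open>Comparison with the centre \<open>a\<close>, where \<open>u\<close> and \<psi>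
    both vanish.\<close>
  have le: "u (Y n) \<le> e n * \<psi> (Y n)" for n
    using min[of a n] R a by simp
  have \<psi>l: "(\<lambda>n. \<psi> (Y n)) \<longlonglongrightarrow> \<psi> l"
    by (rule isCont_tendsto_compose[OF cont(1)[OF l\<Omega>] Yl])
  have lim0: "(\<lambda>n. e n * \<psi> (Y n)) \<longlonglongrightarrow> 0"
    using tendsto_mult[OF \<open>e \<longlonglongrightarrow> 0\<close> \<psi>l] by simp
  have "u l \<le> 0"
    by (rule lsc_on_limit_le[OF lsc l\<Omega> Y\<Omega> Yl lim0 le])
  then have "u l = 0" using u(2)[OF l\<Omega>] by simp
  have "0 \<le> \<psi> (Y n)" for n
    using le[of n] u(2)[OF Y\<Omega>, of n] e[of n] by (smt (verit) zero_le_mult_iff)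
  then have "0 \<le> \<psi> l"
    using \<psi>l by (simp add: LIMSEQ_le_const)
  then have "l = a"
    using strict[OF l\<Omega> \<open>u l = 0\<close>] by fastforce
  \<comment> \<open>Semicontinuity alone does not make the values of \<open>u\<close> converge; the
    squeeze between 0 and \<open>e n * \<psi> (Y n)\<close> does, and the second argument of
    \<open>F\<close> needs it.\<close>
  have uY: "(\<lambda>n. u (Y n)) \<longlonglongrightarrow> 0"
    by (rule tendsto_sandwich[OF _ _ tendsto_const lim0]) (use le u(2) Y\<Omega> in auto)
  have sym: "hessian \<psi> x \<in> sym_matrices" if "x \<in> \<Omega>" for x
    using hessian_symmetric[OF \<open>open \<Omega>\<close> \<psi> that] .
  have lim: "(\<lambda>n. F (Y n) (u (Y n)) (gradient \<psi> (Y n)) (hessian \<psi> (Y n))) \<longlonglongrightarrow>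
        F l 0 (gradient \<psi> l) (hessian \<psi> l)"
    by (rule continuous_operator_tendsto[OF F(1) l\<Omega> sym[OF l\<Omega>] _ _ Yl uY
          isCont_tendsto_compose[OF cont(2)[OF l\<Omega>] Yl]
          isCont_tendsto_compose[OF cont(3)[OF l\<Omega>] Yl]])
       (use Y\<Omega> sym in auto)
  \<comment> \<open>A minimum over the closed ball is a local minimum in \<Omega> once it is
    attained in the interior, which holds eventually since the limit is the centre.\<close>
  have "\<forall>\<^sub>F n in sequentially. Y n \<in> ball a R"
    using Yl \<open>l = a\<close> R(1) by (intro topological_tendstoD) auto
  then have "\<forall>\<^sub>F n in sequentially.
      F (Y n) (u (Y n)) (gradient \<psi> (Y n)) (hessian \<psi> (Y n)) \<le> 0"
  proof eventually_elim
    case (elim n)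
    have "\<forall>\<^sub>F y in at (Y n) within \<Omega>. y \<in> ball a R"
      using elim eventually_at_topological by blast
    then have "local_min_in \<Omega> (\<lambda>y. u y - e n * \<psi> y) (Y n)"
      unfolding local_min_in_def by (rule eventually_mono) (use min in auto)
    then have "F (Y n) (u (Y n)) (gradient (\<lambda>y. e n * \<psi> y) (Y n)) (hessian (\<lambda>y. e n * \<psi> y) (Y n)) \<le> 0"
      using u(1) C2_on_scale(1)[OF \<open>open \<Omega>\<close> \<psi>] Y\<Omega>
      unfolding viscosity_supersolution_def by blast
    \<comment> \<open>Homogeneity with \<open>t = e n\<close>; the positive factor
      \<open>h (e n)\<close> can then be cancelled, however it behaves as \<open>e n\<close> tends
      to 0.\<close>
    then have "h (e n) * F (Y n) (u (Y n)) (gradient \<psi> (Y n)) (hessian \<psi> (Y n)) \<le> 0"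
      using C2_on_scale(2,3)[OF \<open>open \<Omega>\<close> \<psi> Y\<Omega>] h(2)[OF e Y\<Omega> sym[OF Y\<Omega>]] by simp
    then show ?case
      using h(1)[OF e, of n] by (simp add: mult_le_0_iff not_less)
  qed
  then show ?thesis
    using tendsto_upperbound[OF lim] \<open>l = a\<close> by simp
qed

section \<open>From strict to general test functions\<close>

theorem theorem1:
  fixes \<Omega> :: "(real ^ 'n) set"
    and F :: "'n::finite operator"
    and u :: "real ^ 'n \<Rightarrow> real"
  assumes "open \<Omega>"
    and "continuous_operator \<Omega> F"
    and "degenerate_elliptic \<Omega> F"
    and "homogeneous_operator \<Omega> F"
    and "lsc_on \<Omega> u"
    and "viscosity_supersolution \<Omega> F u"
    and "\<exists>x\<^sub>0\<in>\<Omega>. u x\<^sub>0 = 0 \<and> (\<forall>x\<in>\<Omega>. u x\<^sub>0 \<le> u x)"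
  shows "G_condition F \<Omega> {x \<in> \<Omega>. u x > 0}"
  unfolding G_condition_def
proof (intro allI impI)
  fix \<phi> a
  assume \<phi>: "C2_on \<Omega> \<phi>" and a: "a \<in> \<Omega> - {x \<in> \<Omega>. 0 < u x}" "\<phi> a = 0"
    and max: "\<forall>y\<in>\<Omega> - {x \<in> \<Omega>. 0 < u x}. \<phi> y \<le> \<phi> a"
  have nonneg: "0 \<le> u x" if "x \<in> \<Omega>" for x
    using assms(7) that by auto
  \<comment> \<open>With \<open>u\<close> nonnegative, the complement of the positivity set in
    \<Omega> is exactly the zero set of \<open>u\<close>.\<close>
  have a': "a \<in> \<Omega>" "u a = 0" using a(1) nonneg[of a] by auto
  let ?H = "\<lambda>\<delta>. hessian \<phi> a - (2 * \<delta>) *\<^sub>R mat 1"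
  have strict: "F a 0 (gradient \<phi> a) (?H \<delta>) \<le> 0" if "\<delta> > 0" for \<delta>
  proof -
    let ?\<psi> = "\<lambda>y. \<phi> y - \<delta> * ((y - a) \<bullet> (y - a))"
    have "F a 0 (gradient ?\<psi> a) (hessian ?\<psi> a) \<le> 0"
    proof (rule supersolution_strict_test[OF assms(1,2,4,6) nonneg
          C2_on_diff_square(1)[OF assms(1) \<phi>] a'])
      fix y assume y: "y \<in> \<Omega>" "u y = 0" "y \<noteq> a"
      then have "\<phi> y \<le> 0" using max a(2) by auto
      moreover have "0 < \<delta> * ((y - a) \<bullet> (y - a))" using y that by simp
      ultimately show "?\<psi> y < 0" by simp
    qed (use a in auto)
    then show ?thesis
      using C2_on_diff_square(2,3)[OF assms(1) \<phi> a'(1), of \<delta> a] by simp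
  qed
  have sym: "hessian \<phi> a \<in> sym_matrices"
    by (rule hessian_symmetric[OF assms(1) \<phi> a'(1)])
  then have symH: "?H \<delta> \<in> sym_matrices" for \<delta>
    by (auto simp: sym_matrices_def transpose_def vec_eq_iff mat_def)
  \<comment> \<open>The limit is one-sided because the inequality \<open>strict\<close> is available
    only for \<delta> > 0.\<close>
  have limH: "(?H \<longlongrightarrow> hessian \<phi> a) (at_right 0)"
    by (auto intro!: tendsto_eq_intros)
  have "((\<lambda>\<delta>. F a 0 (gradient \<phi> a) (?H \<delta>)) \<longlongrightarrow> F a 0 (gradient \<phi> a) (hessian \<phi> a)) (at_right 0)"
    by (rule continuous_operator_tendsto[OF assms(2) a'(1) sym _ _
          tendsto_const tendsto_const tendsto_const limH]) (use a' symH in auto)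
  then have "F a 0 (gradient \<phi> a) (hessian \<phi> a) \<le> 0"
    by (rule tendsto_upperbound)
       (use strict eventually_at_right_less[of "0::real"] in \<open>auto elim: eventually_mono\<close>)
  then show "F a (\<phi> a) (gradient \<phi> a) (hessian \<phi> a) \<le> 0"
    using a(2) by simp
qed

end
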